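(* Let $q$ be a prime power and let $m,u$ be integers with $m>1$ and $1\le u\le m-1$. Then the code $B_{u,m}$ is completely transitive.
   Context: $\mathbb{F}_q$ is the finite field of order $q$; $d(\cdot,\cdot)$ is the Hamming distance on $\mathbb{F}_q^n$. The covering radius of $C\subset\mathbb{F}_q^n$ is $\rho=\max_{\mathbf v\in\mathbb{F}_q^n}\min_{\mathbf x\in C}d(\mathbf v,\mathbf x)$. For a linear code $C\subset\mathbb{F}_q^n$, $\mathrm{Aut}(C)$ is the group of all maps $\mathbb{F}_q^n\to\mathbb{F}_q^n$ that preserve $C$ and are a composition of a monomial map $\mathbf x\mapsto \mathbf xM$ ($M$ an $n\times n$ matrix over $\mathbb{F}_q$ with exactly one nonzero entry in each row and column) and a field automorphism of $\mathbb{F}_q$ applied coordinatewise (for $q$ prime only monomial maps occur). It acts on the cosets of $C$ by $\pi(\mathbf v+C)=\pi(\mathbf v)+C$. A linear code $C$ with covering radius $\rho$ is completely transitive if $\mathrm{Aut}(C)$ has exactly $\rho+1$ orbits on the set of cosets of $C$. Let $H_m$ be an $m\times (q^m-1)/(q-1)$ matrix over $\mathbb{F}_q$ whose columns form a maximal set of pairwise linearly independent vectors of $\mathbb{F}_q^m$ (a parity-check matrix of the $q$-ary Hamming code). For $1\le u\le m-1$ order the columns so that $H_m=[\,H_u^*\mid H_{u,m}\,]$, where $H_u^*$ consists of the $(q^u-1)/(q-1)$ columns whose last $m-u$ entries are all zero, and $H_{u,m}$ consists of the remaining $n_B=(q^m-q^u)/(q-1)$ columns. Then $B_{u,m}=\{\mathbf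 x\in\mathbb{F}_q^{n_B}: H_{u,m}\mathbf x^T=\mathbf 0^T\}$. *)

theory Defs
  imports
    "HOL-Algebra.AbelCoset"
    "HOL-Algebra.Group_Action"
    "HOL-Library.Cardinality"
    "Jordan_Normal_Form.Matrix_Kernel"
    "Jordan_Normal_Form.VS_Connect"
begin

text \<open>
  The field \<open>\<bbbF>\<^sub>q\<close> is a type \<open>'a :: {field, finite}\<close> with \<open>q = CARD('a)\<close>, and \<open>\<bbbF>\<^sub>q\<^sup>n\<close> is
  \<open>carrier_vec n\<close>. A code of length \<open>n\<close> is a subset of \<open>carrier_vec n\<close>.
\<close>

definition hamming_dist :: "'a vec \<Rightarrow> 'a vec \<Rightarrow> nat" where
  "hamming_dist v w = card {i. i < dim_vec v \<and> v $ i \<noteq> w $ i}"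

definition covering_radius :: "nat \<Rightarrow> 'a vec set \<Rightarrow> nat" where
  "covering_radius n C = (MAX v\<in>carrier_vec n. MIN x\<in>C. hamming_dist v x)"

definition linear_code :: "nat \<Rightarrow> 'a :: field vec set \<Rightarrow> bool" where
  "linear_code n C \<longleftrightarrow> VectorSpace.subspace class_ring C (module_vec TYPE('a) n)"

definition monomial_mat :: "nat \<Rightarrow> 'a :: zero mat \<Rightarrow> bool" where
  "monomial_mat n M \<longleftrightarrow> M \<in> carrier_mat n n \<and>
     (\<forall>i<n. \<exists>!j. j < n \<and> M $$ (i, j) \<noteq> 0) \<and>
     (\<forall>j<n. \<exists>!i. i < n \<and> M $$ (i, j) \<noteq> 0)"

text \<open>
  The row vector \<open>x M\<close> is written \<open>transpose_mat M *\<^sub>v x\<close>. Since \<open>\<sigma>(x M) = \<sigma>(x) \<sigma>(M)\<close> and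
  \<open>\<sigma>(M)\<close> is again monomial, the order of the two factors does not matter.
\<close>

definition semilinear_monomial_maps :: "nat \<Rightarrow> ('a :: field vec \<Rightarrow> 'a vec) set" where
  "semilinear_monomial_maps n =
     {(\<lambda>x\<in>carrier_vec n. map_vec \<sigma> (transpose_mat M *\<^sub>v x)) | M \<sigma>.
        monomial_mat n M \<and> field_isom \<sigma>}"

definition Aut_code :: "nat \<Rightarrow> 'a :: field vec set \<Rightarrow> ('a vec \<Rightarrow> 'a vec) monoid" where
  "Aut_code n C =
     BijGroup (carrier_vec n) \<lparr>carrier := {f \<in> semilinear_monomial_maps n. f ` C = C}\<rparr>"

definition code_coset :: "nat \<Rightarrow> 'a :: field vec \<Rightarrow> 'a vec set \<Rightarrow> 'a vec set" where
  "code_coset n v C = v <+\<^bsub>module_vec TYPE('a) n\<^esub> C"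

definition code_cosets :: "nat \<Rightarrow> 'a :: field vec set \<Rightarrow> 'a vec set set" where
  "code_cosets n C = (\<lambda>v. code_coset n v C) ` carrier_vec n"

text \<open>
  A map \<open>f\<close> acts on a coset by taking its image; by the following lemma this is
  \<open>f (v + C) = f v + C\<close>.
\<close>

lemma image_code_coset:
  assumes "linear_code n C" "f \<in> carrier (Aut_code n C)" "v \<in> carrier_vec n"
  shows "f ` code_coset n v C = code_coset n (f v) C"
proof -
  from assms(2) obtain M \<sigma> where M: "monomial_mat n M" and \<sigma>: "field_isom \<sigma>"
    and f: "f = (\<lambda>x\<in>carrier_vec n. map_vec \<sigma> (transpose_mat M *\<^sub>v x))" and fC: "f ` C = C"
    by (auto simp: Aut_code_def semilinear_monomial_maps_def)
  interpret field_isom \<sigma> by fact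
  have Mc: "transpose_mat M \<in> carrier_mat n n" using M by (auto simp: monomial_mat_def)
  have C: "C \<subseteq> carrier_vec n"
    using assms(1) by (auto simp: linear_code_def subspace_def submodule_def module_vec_simps)
  have add: "f (v + c) = f v + f c" if "c \<in> C" for c
  proof -
    have c: "c \<in> carrier_vec n" using that C by blast
    have "transpose_mat M *\<^sub>v (v + c) = transpose_mat M *\<^sub>v v + transpose_mat M *\<^sub>v c"
      using Mc assms(3) c by (rule mult_add_distrib_mat_vec)
    then show ?thesis using assms(3) c Mc by (auto simp: f intro!: eq_vecI simp: hom_add)
  qed
  have coset: "code_coset n w C = (\<lambda>c. w + c) ` C" for w
    by (auto simp: code_coset_def a_l_coset_def' module_vec_simps)
  have "f ` code_coset n v C = (\<lambda>c. f v + f c) ` C"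
    unfolding coset image_image using add by (intro image_cong) auto
  also have "\<dots> = (\<lambda>c. f v + c) ` (f ` C)" by (simp only: image_image)
  finally show ?thesis by (simp only: fC coset)
qed

definition completely_transitive :: "nat \<Rightarrow> 'a :: field vec set \<Rightarrow> bool" where
  "completely_transitive n C \<longleftrightarrow> linear_code n C \<and>
     card (orbits (Aut_code n C) (code_cosets n C) (\<lambda>f K. f ` K)) = covering_radius n C + 1"

text \<open>
  The case \<open>v = w\<close> is included on purpose: it excludes the zero vector.
\<close>

definition pairwise_lin_indpt :: "nat \<Rightarrow> 'a :: field vec set \<Rightarrow> bool" where
  "pairwise_lin_indpt m S \<longleftrightarrow>
     (\<forall>v\<in>S. \<forall>w\<in>S. LinearCombinations.module.lin_indpt class_ring (module_vec TYPE('a) m) {v, w})"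

definition hamming_parity_check :: "nat \<Rightarrow> 'a :: {field, finite} mat \<Rightarrow> bool" where
  "hamming_parity_check m H \<longleftrightarrow>
     H \<in> carrier_mat m ((CARD('a) ^ m - 1) div (CARD('a) - 1)) \<and> distinct (cols H) \<and>
     maximal (set (cols H)) (\<lambda>S. S \<subseteq> carrier_vec m \<and> pairwise_lin_indpt m S)"

text \<open>
  \<open>hamming_split u m A B\<close>: the block matrix \<open>[A | B]\<close> is a parity-check matrix \<open>H\<^sub>m\<close> of the
  Hamming code, \<open>A = H\<^sub>u\<^sup>*\<close> collects the columns of \<open>H\<^sub>m\<close> whose last \<open>m - u\<close> entries vanish,
  and \<open>B = H\<^sub>u\<^sub>,\<^sub>m\<close> collects the remaining ones.
\<close>

definition hamming_split :: "nat \<Rightarrow> nat \<Rightarrow> 'a :: {field, finite} mat \<Rightarrow> 'a mat \<Rightarrow> bool" where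
  "hamming_split u m A B \<longleftrightarrow>
     A \<in> carrier_mat m ((CARD('a) ^ u - 1) div (CARD('a) - 1)) \<and>
     B \<in> carrier_mat m ((CARD('a) ^ m - CARD('a) ^ u) div (CARD('a) - 1)) \<and>
     hamming_parity_check m (mat_of_cols m (cols A @ cols B)) \<and>
     (\<forall>c\<in>set (cols A). \<forall>i. u \<le> i \<and> i < m \<longrightarrow> c $ i = 0) \<and>
     (\<forall>c\<in>set (cols B). \<not> (\<forall>i. u \<le> i \<and> i < m \<longrightarrow> c $ i = 0))"

end

theory Submission
  imports Defs
begin

text \<open>
  Write \<open>U\<close> for the subspace of vectors whose last \<open>m - u\<close> entries vanish. The columns of
  \<open>H\<^sub>u\<^sub>,\<^sub>m\<close> represent every line of \<open>\<bbbF>\<^sub>q\<^sup>m\<close> that is not contained in \<open>U\<close> exactly once, by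
  maximality and pairwise independence (\<open>hamming_split_lines_outside\<close>). Cosets of the code
  correspond to syndromes \<open>s \<in> \<bbbF>\<^sub>q\<^sup>m\<close>, and the distance of a coset from the code is the least
  number of columns whose span contains \<open>s\<close> (\<open>dist_to_kernel\<close> computes it). That number
  is \<open>0\<close> for \<open>s = 0\<close>, it is \<open>1\<close> for \<open>s \<notin> U\<close> because \<open>s\<close> is a multiple of a column, and it is \<open>2\<close> for
  \<open>s \<in> U - {0}\<close> because \<open>s = (s + p) - p\<close> for any \<open>p \<notin> U\<close>. Since \<open>u \<ge> 1\<close>, all three
  cases occur, and the covering radius is \<open>2\<close>.

  Automorphisms are isometries that preserve the code, so each orbit on the cosets lies in one
  distance class, and it remains to see that each class is a single orbit. A linear bijection \<open>T\<close> of
  \<open>\<bbbF>\<^sub>q\<^sup>m\<close> that preserves \<open>U\<close> permutes the lines outside \<open>U\<close>; on the columns it acts as a permutation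
  up to nonzero scalars, which is a monomial map of \<open>\<bbbF>\<^sub>q\<^sup>n\<close> that realizes \<open>T\<close> on syndromes
  (\<open>automorphism_realizing\<close>). Two nonzero syndromes that are both in \<open>U\<close> or both outside \<open>U\<close> are
  carried to one another by a single map of the form \<open>x \<mapsto> x + (f \<bullet> x) a\<close> that preserves \<open>U\<close>
  (\<open>subspace_stabilizer_transitive\<close>). Hence there are exactly three orbits.
\<close>

section \<open>Distance from a code and its invariance under automorphisms\<close>

definition dist_to_code :: "'a vec \<Rightarrow> 'a vec set \<Rightarrow> nat" where
  "dist_to_code v C = (MIN x\<in>C. hamming_dist v x)"

lemma finite_carrier_vec: "finite (carrier_vec n :: 'a :: finite vec set)"
proof (rule finite_subset)
  show "(carrier_vec n :: 'a vec set) \<subseteq> vec_of_list ` {xs. set xs \<subseteq> UNIV \<and> length xs = n}"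
  proof
    fix v :: "'a vec" assume "v \<in> carrier_vec n"
    then have "v = vec_of_list (list_of_vec v)" "length (list_of_vec v) = n"
      by (auto simp: vec_list)
    then show "v \<in> vec_of_list ` {xs. set xs \<subseteq> UNIV \<and> length xs = n}" by blast
  qed
qed (intro finite_imageI finite_lists_length_eq finite)

text \<open>
  The Hamming distance counts the coordinates in which two vectors differ; a semilinear monomial
  map only permutes the coordinates and applies an injective function to each of them.
\<close>

lemma hamming_dist_semilinear_monomial:
  fixes f :: "'a :: field vec \<Rightarrow> 'a vec"
  assumes f: "f \<in> semilinear_monomial_maps n"
    and x: "x \<in> carrier_vec n" and y: "y \<in> carrier_vec n"
  shows "hamming_dist (f x) (f y) = hamming_dist x y"
proof -
  from f obtain M \<sigma> where M: "monomial_mat n M" and \<sigma>: "field_isom \<sigma>"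
    and f_eq: "f = (\<lambda>x\<in>carrier_vec n. map_vec \<sigma> (transpose_mat M *\<^sub>v x))"
    by (auto simp: semilinear_monomial_maps_def)
  interpret field_isom \<sigma> by fact
  have Mc: "M \<in> carrier_mat n n" using M by (auto simp: monomial_mat_def)
  have row: "\<exists>!j. j < n \<and> M $$ (i, j) \<noteq> 0" if "i < n" for i
    using M that by (simp add: monomial_mat_def)
  have col: "\<exists>!i. i < n \<and> M $$ (i, j) \<noteq> 0" if "j < n" for j
    using M that by (simp add: monomial_mat_def)
  define \<tau> where "\<tau> j = (THE i. i < n \<and> M $$ (i, j) \<noteq> 0)" for j
  have \<tau>: "\<tau> j < n" "M $$ (\<tau> j, j) \<noteq> 0" if "j < n" for j
    using theI'[OF col[OF that]] by (simp_all add: \<tau>_def)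
  have uniq: "i = \<tau> j" if "i < n" "j < n" "M $$ (i, j) \<noteq> 0" for i j
    using col[OF that(2)] that \<tau>[OF that(2)] by blast
  have inj: "inj_on \<tau> {..<n}"
  proof (rule inj_onI)
    fix j k assume "j \<in> {..<n}" "k \<in> {..<n}" and eq: "\<tau> j = \<tau> k"
    then have "j < n" "k < n" by auto
    then show "j = k" using row[OF \<tau>(1)[of j]] \<tau>(2)[of j] \<tau>(2)[of k] eq by auto
  qed
  have "\<tau> ` {..<n} = {..<n}" using inj \<tau>(1) by (intro endo_inj_surj) auto
  then have surj: "\<exists>j<n. \<tau> j = i" if "i < n" for i
    using that by (metis imageE lessThan_iff)
  have coord: "f z $ j = \<sigma> (M $$ (\<tau> j, j) * z $ \<tau> j)" if z: "z \<in> carrier_vec n" and j: "j < n" for z j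
  proof -
    have zero: "M $$ (i, j) = 0" if "i < n" "i \<noteq> \<tau> j" for i
      using uniq[OF that(1) j] that(2) by blast
    have "(transpose_mat M *\<^sub>v z) $ j = (\<Sum>i\<in>{0..<n}. M $$ (i, j) * z $ i)"
      using Mc z j by (simp add: scalar_prod_def)
    also have "\<dots> = (\<Sum>i\<in>{\<tau> j}. M $$ (i, j) * z $ i)"
      using \<tau>(1)[OF j] zero by (intro sum.mono_neutral_right) auto
    finally show ?thesis using Mc z j by (simp add: f_eq)
  qed
  have dim: "dim_vec (f x) = n" using Mc x by (simp add: f_eq)
  have "bij_betw \<tau> {j. j < n \<and> f x $ j \<noteq> f y $ j} {i. i < n \<and> x $ i \<noteq> y $ i}"
  proof (rule bij_betw_imageI)
    show "inj_on \<tau> {j. j < n \<and> f x $ j \<noteq> f y $ j}" by (rule inj_on_subset[OF inj]) auto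
    have "f x $ j \<noteq> f y $ j \<longleftrightarrow> x $ \<tau> j \<noteq> y $ \<tau> j" if "j < n" for j
      using that coord[OF x that] coord[OF y that] \<tau>(2)[OF that] by simp
    then show "\<tau> ` {j. j < n \<and> f x $ j \<noteq> f y $ j} = {i. i < n \<and> x $ i \<noteq> y $ i}"
      using \<tau>(1) surj by (force simp: image_iff)
  qed
  then show ?thesis using x dim by (auto simp: hamming_dist_def dest: bij_betw_same_card)
qed

lemma Aut_codeD:
  assumes "f \<in> carrier (Aut_code n C)"
  shows "f \<in> semilinear_monomial_maps n" "f ` C = C"
  using assms by (auto simp: Aut_code_def)

lemma Aut_code_closed:
  assumes "f \<in> carrier (Aut_code n C)" "v \<in> carrier_vec n"
  shows "f v \<in> carrier_vec n"
  using Aut_codeD(1)[OF assms(1)] assms(2)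
  by (auto simp: semilinear_monomial_maps_def monomial_mat_def)

lemma dist_to_code_Aut:
  assumes f: "f \<in> carrier (Aut_code n C)" and C: "C \<subseteq> carrier_vec n" and v: "v \<in> carrier_vec n"
  shows "dist_to_code (f v) C = dist_to_code v C"
proof -
  have "hamming_dist (f v) ` C = hamming_dist (f v) ` (f ` C)"
    by (simp only: Aut_codeD(2)[OF f])
  also have "\<dots> = hamming_dist v ` C"
    unfolding image_image
    using hamming_dist_semilinear_monomial[OF Aut_codeD(1)[OF f] v] C by (intro image_cong) auto
  finally show ?thesis by (simp add: dist_to_code_def)
qed

lemma mem_code_coset: "x \<in> code_coset n v C \<longleftrightarrow> (\<exists>c\<in>C. x = v + c)"
  by (auto simp: code_coset_def a_l_coset_def' module_vec_simps)

lemma linear_codeD: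
  fixes C :: "'a :: field vec set"
  assumes "linear_code n C"
  shows "C \<subseteq> carrier_vec n" "0\<^sub>v n \<in> C" "\<And>c d. c \<in> C \<Longrightarrow> d \<in> C \<Longrightarrow> c + d \<in> C"
  using assms by (auto simp: linear_code_def subspace_def submodule_def module_vec_simps)

text \<open>
  If \<open>v = w + c\<close> with \<open>c \<in> C\<close>, translation by \<open>c\<close> permutes the finite set \<open>C\<close> and turns the
  distances from \<open>w\<close> into those from \<open>v\<close>.
\<close>

lemma dist_to_code_cong_coset:
  fixes C :: "'a :: {field, finite} vec set"
  assumes lin: "linear_code n C" and v: "v \<in> carrier_vec n" and w: "w \<in> carrier_vec n"
    and eq: "code_coset n v C = code_coset n w C"
  shows "dist_to_code v C = dist_to_code w C"
proof -
  note C = linear_codeD[OF lin]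
  have "v \<in> code_coset n w C"
    using C(2) v unfolding eq[symmetric] mem_code_coset by (intro bexI[of _ "0\<^sub>v n"]) auto
  then obtain c where c: "c \<in> C" and vw: "v = w + c" by (auto simp: mem_code_coset)
  have cn: "c \<in> carrier_vec n" using c C(1) by blast
  have inj: "inj_on (\<lambda>x. x + c) C"
  proof (rule inj_onI)
    fix x y assume "x \<in> C" "y \<in> C" and eq: "x + c = y + c"
    then have xy: "x \<in> carrier_vec n" "y \<in> carrier_vec n" using C(1) by auto
    have "x $ i + c $ i = y $ i + c $ i" if "i < n" for i
      using arg_cong[OF eq, of "\<lambda>v. v $ i"] that xy cn by simp
    then show "x = y" using xy by (intro eq_vecI) auto
  qed
  have "(\<lambda>x. x + c) ` C = C"
    using finite_subset[OF C(1) finite_carrier_vec] inj C(3)[OF _ c] by (intro endo_inj_surj) auto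
  then have "hamming_dist v ` C = (\<lambda>x. hamming_dist v (x + c)) ` C"
    by (metis image_image)
  also have "\<dots> = hamming_dist w ` C"
  proof (rule image_cong[OF refl])
    fix x assume "x \<in> C"
    then have x: "x \<in> carrier_vec n" using C(1) by blast
    show "hamming_dist v (x + c) = hamming_dist w x"
      using w cn x unfolding hamming_dist_def vw by (intro arg_cong[where f = card]) auto
  qed
  finally show ?thesis by (simp add: dist_to_code_def)
qed

text \<open>
  Since the distance from the code is invariant, the number of orbits is at least the number of
  attained distances. Transitivity on each distance class turns this into an equality.
\<close>

lemma completely_transitiveI:
  fixes C :: "'a :: {field, finite} vec set"
  assumes lin: "linear_code n C"
    and dists: "(\<lambda>v. dist_to_code v C) ` carrier_vec n = {..r}"
    and trans: "\<And>v w. v \<in> carrier_vec n \<Longrightarrow> w \<in> carrier_vec n \<Longrightarrow>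
      dist_to_code v C = dist_to_code w C \<Longrightarrow>
      \<exists>f\<in>carrier (Aut_code n C). code_coset n (f v) C = code_coset n w C"
  shows "completely_transitive n C"
proof -
  note C = linear_codeD[OF lin]
  define D where "D k = {code_coset n w C | w. w \<in> carrier_vec n \<and> dist_to_code w C = k}" for k
  let ?orb = "orbit (Aut_code n C) (\<lambda>f K. f ` K)"
  have orb: "?orb (code_coset n v C) = D (dist_to_code v C)" if v: "v \<in> carrier_vec n" for v
  proof (intro equalityI subsetI)
    fix K assume "K \<in> ?orb (code_coset n v C)"
    then obtain f where f: "f \<in> carrier (Aut_code n C)" and K: "K = code_coset n (f v) C"
      using image_code_coset[OF lin _ v] by (auto simp: orbit_def)
    then show "K \<in> D (dist_to_code v C)"
      using Aut_code_closed[OF f v] dist_to_code_Aut[OF f C(1) v] by (auto simp: D_def)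
  next
    fix K assume "K \<in> D (dist_to_code v C)"
    then obtain w where w: "w \<in> carrier_vec n" "dist_to_code v C = dist_to_code w C"
      and K: "K = code_coset n w C" by (auto simp: D_def)
    obtain f where f: "f \<in> carrier (Aut_code n C)" "code_coset n (f v) C = K"
      using trans[OF v w] K by blast
    then show "K \<in> ?orb (code_coset n v C)"
      using image_code_coset[OF lin f(1) v] by (auto simp: orbit_def)
  qed
  have "orbits (Aut_code n C) (code_cosets n C) (\<lambda>f K. f ` K)
      = (\<lambda>v. ?orb (code_coset n v C)) ` carrier_vec n"
    by (auto simp: orbits_def code_cosets_def)
  also have "\<dots> = D ` (\<lambda>v. dist_to_code v C) ` carrier_vec n"
    unfolding image_image using orb by (intro image_cong) auto
  also have "\<dots> = D ` {..r}" by (simp only: dists)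
  finally have "orbits (Aut_code n C) (code_cosets n C) (\<lambda>f K. f ` K) = D ` {..r}" .
  moreover have "inj_on D {..r}"
  proof (rule inj_onI)
    fix k l assume "k \<in> {..r}" and eq: "D k = D l"
    then obtain v where v: "v \<in> carrier_vec n" "dist_to_code v C = k" using dists by (metis imageE)
    then have "code_coset n v C \<in> D l" using eq by (auto simp: D_def)
    then show "k = l" using dist_to_code_cong_coset[OF lin v(1)] v(2) by (auto simp: D_def)
  qed
  moreover have "covering_radius n C = r"
  proof -
    have "covering_radius n C = Max ((\<lambda>v. dist_to_code v C) ` carrier_vec n)"
      by (simp add: covering_radius_def dist_to_code_def)
    also have "\<dots> = r" unfolding dists by (intro Max_eqI) auto
    finally show ?thesis .
  qed
  ultimately show ?thesis using lin by (simp add: completely_transitive_def card_image)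
qed

section \<open>Linear maps that preserve the coordinate subspace\<close>

definition last_zero_space :: "nat \<Rightarrow> nat \<Rightarrow> 'a :: zero vec set" where
  "last_zero_space u m = {x \<in> carrier_vec m. \<forall>i. u \<le> i \<and> i < m \<longrightarrow> x $ i = 0}"

lemma zero_in_last_zero_space: "0\<^sub>v m \<in> last_zero_space u m"
  by (auto simp: last_zero_space_def)

lemma smult_in_last_zero_space_iff:
  fixes c :: "'a :: field"
  assumes "c \<noteq> 0" "x \<in> carrier_vec m"
  shows "c \<cdot>\<^sub>v x \<in> last_zero_space u m \<longleftrightarrow> x \<in> last_zero_space u m"
  using assms by (auto simp: last_zero_space_def)

lemma add_in_last_zero_space_iff:
  fixes a :: "'a :: field vec"
  assumes "a \<in> last_zero_space u m" "x \<in> carrier_vec m"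
  shows "x + a \<in> last_zero_space u m \<longleftrightarrow> x \<in> last_zero_space u m"
  using assms by (auto simp: last_zero_space_def)

text \<open>
  If no single coordinate is nonzero on both vectors, the sum of two coordinates is: each summand
  then vanishes on the other vector. Scaling achieves the value \<open>1\<close>.
\<close>

lemma functional_on_two_vectors:
  fixes w w' :: "'a :: field vec"
  assumes w: "w \<in> carrier_vec m" and w': "w' \<in> carrier_vec m"
    and I: "I \<subseteq> {..<m}" and i: "i \<in> I" "w $ i \<noteq> 0" and j: "j \<in> I" "w' $ j \<noteq> 0"
  obtains f where "f \<in> carrier_vec m" "\<And>k. k < m \<Longrightarrow> k \<notin> I \<Longrightarrow> f $ k = 0"
    "f \<bullet> w = 1" "f \<bullet> w' \<noteq> 0"
proof -
  have "\<exists>g\<in>carrier_vec m. (\<forall>k<m. k \<notin> I \<longrightarrow> g $ k = 0) \<and> g \<bullet> w \<noteq> 0 \<and> g \<bullet> w' \<noteq> 0"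
  proof -
    have im: "i < m" and jm: "j < m" using i j I by auto
    consider "w' $ i \<noteq> 0" | "w $ j \<noteq> 0" | "w' $ i = 0" "w $ j = 0" by blast
    then show ?thesis
    proof cases
      case 1
      then show ?thesis using im i w w' by (intro bexI[of _ "unit_vec m i"]) auto
    next
      case 2
      then show ?thesis using jm j w w' by (intro bexI[of _ "unit_vec m j"]) auto
    next
      case 3
      then show ?thesis using im jm i j w w'
        by (intro bexI[of _ "unit_vec m i + unit_vec m j"])
          (auto simp: add_scalar_prod_distrib[of _ m])
    qed
  qed
  then obtain g where g: "g \<in> carrier_vec m" "\<forall>k<m. k \<notin> I \<longrightarrow> g $ k = 0"
    "g \<bullet> w \<noteq> 0" "g \<bullet> w' \<noteq> 0" by blast
  show thesis
    by (rule that[of "(1 / (g \<bullet> w)) \<cdot>\<^sub>v g"]) (use g w w' in auto)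
qed

definition rank_one_update_mat :: "nat \<Rightarrow> 'a :: field vec \<Rightarrow> 'a vec \<Rightarrow> 'a mat" where
  "rank_one_update_mat m f a = mat m m (\<lambda>(i, j). (if i = j then 1 else 0) + a $ i * f $ j)"

lemma rank_one_update_mat_mult:
  assumes "f \<in> carrier_vec m" "a \<in> carrier_vec m" "x \<in> carrier_vec m"
  shows "rank_one_update_mat m f a *\<^sub>v x = x + (f \<bullet> x) \<cdot>\<^sub>v a"
proof (rule eq_vecI)
  fix i assume "i < dim_vec (x + (f \<bullet> x) \<cdot>\<^sub>v a)"
  then have i: "i < m" using assms by auto
  have "(rank_one_update_mat m f a *\<^sub>v x) $ i
      = (\<Sum>j\<in>{0..<m}. ((if i = j then 1 else 0) + a $ i * f $ j) * x $ j)"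
    using i assms unfolding rank_one_update_mat_def by (auto simp: scalar_prod_def intro!: sum.cong)
  also have "\<dots> = (\<Sum>j\<in>{0..<m}. (if i = j then x $ j else 0) + a $ i * (f $ j * x $ j))"
    by (rule sum.cong) (auto simp: distrib_right mult.assoc)
  also have "\<dots> = x $ i + a $ i * (\<Sum>j\<in>{0..<m}. f $ j * x $ j)"
    using i by (simp add: sum.distrib sum_distrib_left)
  finally show "(rank_one_update_mat m f a *\<^sub>v x) $ i = (x + (f \<bullet> x) \<cdot>\<^sub>v a) $ i"
    using i assms by (simp add: scalar_prod_def mult.commute)
qed (use assms in \<open>auto simp: rank_one_update_mat_def\<close>)

text \<open>
  With \<open>f \<bullet> w = 1\<close> and \<open>a = w' - w\<close>, the map \<open>x \<mapsto> x + (f \<bullet> x) a\<close> sends \<open>w\<close> to \<open>w'\<close>, and it is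
  injective because \<open>1 + f \<bullet> a = f \<bullet> w' \<noteq> 0\<close>. For \<open>w, w' \<in> U\<close> it changes vectors by elements of
  \<open>U\<close> only; for \<open>w, w' \<notin> U\<close> the functional \<open>f\<close> can be supported on the last coordinates, so that
  the map fixes \<open>U\<close> pointwise.
\<close>

lemma subspace_stabilizer_transitive:
  fixes w w' :: "'a :: field vec"
  assumes w: "w \<in> carrier_vec m" "w \<noteq> 0\<^sub>v m" and w': "w' \<in> carrier_vec m" "w' \<noteq> 0\<^sub>v m"
    and same: "w \<in> last_zero_space u m \<longleftrightarrow> w' \<in> last_zero_space u m"
  obtains T where "T \<in> carrier_mat m m" "T *\<^sub>v w = w'"
    "\<And>x. x \<in> carrier_vec m \<Longrightarrow> T *\<^sub>v x = 0\<^sub>v m \<Longrightarrow> x = 0\<^sub>v m"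
    "\<And>x. x \<in> carrier_vec m \<Longrightarrow> T *\<^sub>v x \<in> last_zero_space u m \<longleftrightarrow> x \<in> last_zero_space u m"
proof -
  let ?U = "last_zero_space u m :: 'a vec set"
  \<comment> \<open>The coordinates that \<open>f\<close> may use; outside \<open>U\<close> the last ones suffice to detect \<open>w\<close> and \<open>w'\<close>.\<close>
  define I where "I = (if w \<in> ?U then {..<m} else {u..<m})"
  have ex: "\<exists>i\<in>I. z $ i \<noteq> 0" if z: "z \<in> carrier_vec m" "z \<noteq> 0\<^sub>v m" "z \<in> ?U \<longleftrightarrow> w \<in> ?U" for z
  proof (rule ccontr)
    assume *: "\<not> ?thesis"
    show False
    proof (cases "w \<in> ?U")
      case True
      then have "z = 0\<^sub>v m" using * z(1) by (intro eq_vecI) (auto simp: I_def)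
      then show False using z(2) by simp
    next
      case False
      then show False using * z by (auto simp: I_def last_zero_space_def)
    qed
  qed
  obtain i j where ij: "i \<in> I" "w $ i \<noteq> 0" "j \<in> I" "w' $ j \<noteq> 0"
    using ex[OF w] ex[OF w'] same by blast
  have "I \<subseteq> {..<m}" by (auto simp: I_def)
  from functional_on_two_vectors[OF w(1) w'(1) this ij] obtain f
    where f: "f \<in> carrier_vec m" "\<And>k. k < m \<Longrightarrow> k \<notin> I \<Longrightarrow> f $ k = 0"
      "f \<bullet> w = 1" "f \<bullet> w' \<noteq> 0" by metis
  define a where "a = w' - w"
  have a: "a \<in> carrier_vec m" using w w' by (auto simp: a_def)
  let ?T = "rank_one_update_mat m f a"
  have T: "?T *\<^sub>v x = x + (f \<bullet> x) \<cdot>\<^sub>v a" if "x \<in> carrier_vec m" for x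
    using rank_one_update_mat_mult[OF f(1) a that] .
  have fT: "f \<bullet> (?T *\<^sub>v x) = (f \<bullet> x) * (f \<bullet> w')" if x: "x \<in> carrier_vec m" for x
  proof -
    have "f \<bullet> w' = 1 + f \<bullet> a"
      using f w w' by (simp add: a_def scalar_prod_minus_distrib[of _ m])
    moreover have "f \<bullet> (?T *\<^sub>v x) = f \<bullet> x + (f \<bullet> x) * (f \<bullet> a)"
      using f(1) a x by (simp add: T scalar_prod_add_distrib[of _ m])
    ultimately show ?thesis by (simp only: distrib_left mult_1_right)
  qed
  have fixed: "?T *\<^sub>v x = x" if x: "x \<in> carrier_vec m" and "f \<bullet> x = 0" for x
    using that a by (intro eq_vecI) (auto simp: T)
  show thesis
  proof (rule that[of ?T])
    show "?T \<in> carrier_mat m m" by (simp add: rank_one_update_mat_def)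
    have "?T *\<^sub>v w = w + a" using T[OF w(1)] f(3) by simp
    also have "\<dots> = w'" unfolding a_def using w w' by (intro eq_vecI) auto
    finally show "?T *\<^sub>v w = w'" .
  next
    fix x :: "'a vec" assume x: "x \<in> carrier_vec m" and "?T *\<^sub>v x = 0\<^sub>v m"
    then have "f \<bullet> x = 0" using fT[OF x] f by simp
    then show "x = 0\<^sub>v m" using fixed[OF x] \<open>?T *\<^sub>v x = 0\<^sub>v m\<close> by simp
  next
    fix x :: "'a vec" assume x: "x \<in> carrier_vec m"
    show "?T *\<^sub>v x \<in> ?U \<longleftrightarrow> x \<in> ?U"
    proof (cases "w \<in> ?U")
      case True
      then have "(f \<bullet> x) \<cdot>\<^sub>v a \<in> ?U" using same by (auto simp: a_def last_zero_space_def)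
      then show ?thesis using add_in_last_zero_space_iff x by (simp add: T)
    next
      case False
      then have f_low: "f $ k = 0" if "k < u" "k < m" for k
        using f(2)[OF that(2)] that by (simp add: I_def)
      have fU: "f \<bullet> z = 0" if z: "z \<in> ?U" for z
        unfolding scalar_prod_def
      proof (rule sum.neutral, rule ballI)
        fix k assume "k \<in> {0..<dim_vec z}"
        then have "k < m" using z by (auto simp: last_zero_space_def)
        then show "f $ k * z $ k = 0"
          using f_low z by (cases "k < u") (auto simp: last_zero_space_def)
      qed
      show ?thesis
      proof
        assume "?T *\<^sub>v x \<in> ?U"
        then have "f \<bullet> x = 0" using fU fT[OF x] f(4) by fastforce
        then show "x \<in> ?U" using fixed[OF x] \<open>?T *\<^sub>v x \<in> ?U\<close> by simp
      next
        assume "x \<in> ?U"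
        then show "?T *\<^sub>v x \<in> ?U" using fU fixed[OF x] by simp
      qed
    qed
  qed
qed

section \<open>Matrices whose columns represent the lines outside the subspace\<close>

locale lines_outside =
  fixes u m n :: nat and B :: "'a :: {field, finite} mat"
  assumes u_pos: "0 < u" and u_less: "u < m"
    and B: "B \<in> carrier_mat m n"
    and col_outside: "j < n \<Longrightarrow> col B j \<notin> last_zero_space u m"
    and line_represented: "w \<in> carrier_vec m \<Longrightarrow> w \<notin> last_zero_space u m \<Longrightarrow>
      \<exists>j<n. \<exists>c. c \<noteq> 0 \<and> w = c \<cdot>\<^sub>v col B j"
    and line_unique: "j < n \<Longrightarrow> k < n \<Longrightarrow> c \<noteq> 0 \<Longrightarrow> c \<cdot>\<^sub>v col B j = d \<cdot>\<^sub>v col B k \<Longrightarrow> j = k"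
begin

abbreviation "U \<equiv> last_zero_space u m :: 'a vec set"

definition syndrome_weight :: "'a vec \<Rightarrow> nat" where
  "syndrome_weight s = (if s = 0\<^sub>v m then 0 else if s \<in> U then 2 else 1)"

lemma col_carrier: "col B j \<in> carrier_vec m"
  using B by auto

lemma not_in_U: "x $ u \<noteq> 0 \<Longrightarrow> x \<notin> U"
  using u_less by (auto simp: last_zero_space_def)

lemma mult_smult_unit_vec:
  assumes "j < n"
  shows "B *\<^sub>v (c \<cdot>\<^sub>v unit_vec n j) = c \<cdot>\<^sub>v col B j"
proof -
  have "B *\<^sub>v unit_vec n j = col B j"
    using B assms by (intro eq_vecI) auto
  then show ?thesis using mult_mat_vec[OF B unit_vec_carrier] by simp
qed

text \<open>
  An error of weight one has a multiple of a column as its syndrome, and that lies outside \<open>U\<close>; so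
  nonzero syndromes in \<open>U\<close> need weight at least two.
\<close>

lemma syndrome_weight_le:
  assumes e: "e \<in> carrier_vec n"
  shows "syndrome_weight (B *\<^sub>v e) \<le> card {i. i < n \<and> e $ i \<noteq> 0}" (is "_ \<le> card ?S")
proof -
  have fin: "finite ?S" by auto
  consider "card ?S = 0" | "card ?S = 1" | "card ?S \<ge> 2" by linarith
  then show ?thesis
  proof cases
    case 1
    then have "e = 0\<^sub>v n" using fin e by (intro eq_vecI) auto
    then have "B *\<^sub>v e = 0\<^sub>v m" using B by (intro eq_vecI) auto
    then show ?thesis by (simp add: syndrome_weight_def)
  next
    case 2
    then obtain j where S: "?S = {j}" by (auto simp: card_1_singleton_iff)
    then have j: "j < n" "e $ j \<noteq> 0" by auto
    have "e $ i = 0" if "i < n" "i \<noteq> j" for i using S that by auto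
    then have "e = e $ j \<cdot>\<^sub>v unit_vec n j" using e j by (intro eq_vecI) auto
    then have "B *\<^sub>v e = e $ j \<cdot>\<^sub>v col B j" using mult_smult_unit_vec[OF j(1)] by metis
    then have "B *\<^sub>v e \<notin> U"
      using col_outside[OF j(1)] smult_in_last_zero_space_iff[OF j(2) col_carrier] by simp
    then show ?thesis using 2 by (simp add: syndrome_weight_def)
  qed (auto simp: syndrome_weight_def)
qed

lemma exists_light_error:
  assumes s: "s \<in> carrier_vec m"
  obtains e where "e \<in> carrier_vec n" "B *\<^sub>v e = s"
    "card {i. i < n \<and> e $ i \<noteq> 0} \<le> syndrome_weight s"
proof -
  consider "s = 0\<^sub>v m" | "s \<notin> U" | "s \<in> U" "s \<noteq> 0\<^sub>v m" by blast
  then show thesis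
  proof cases
    case 1
    have "B *\<^sub>v 0\<^sub>v n = 0\<^sub>v m" using B by (intro eq_vecI) auto
    moreover have wt: "card {i. i < n \<and> (0\<^sub>v n :: 'a vec) $ i \<noteq> 0} \<le> k" for k
      by (rule ord_eq_le_trans[OF _ le0]) (simp add: card_eq_0_iff)
    ultimately show thesis using 1 by (intro that[OF _ _ wt]) simp_all
  next
    case 2
    obtain j c where j: "j < n" and s_eq: "s = c \<cdot>\<^sub>v col B j" using line_represented[OF s 2] by blast
    have "card {i. i < n \<and> (c \<cdot>\<^sub>v unit_vec n j) $ i \<noteq> 0} \<le> card {j}"
      by (rule card_mono) (auto simp: unit_vec_def split: if_splits)
    moreover have "s \<noteq> 0\<^sub>v m" using 2 zero_in_last_zero_space by blast
    ultimately show thesis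
      using 2 mult_smult_unit_vec[OF j] s_eq
      by (intro that[of "c \<cdot>\<^sub>v unit_vec n j"]) (auto simp: syndrome_weight_def)
  next
    case 3
    \<comment> \<open>Any vector outside \<open>U\<close> could serve as \<open>p\<close>; then \<open>s - p\<close> is outside \<open>U\<close> as well.\<close>
    define p where "p = - (unit_vec m u :: 'a vec)"
    have p: "p \<in> carrier_vec m" "p $ u = -1" using u_less by (auto simp: p_def)
    have q: "s - p \<in> carrier_vec m" "(s - p) $ u = 1"
      using p u_less 3(1) s by (auto simp: last_zero_space_def)
    have pU: "p \<notin> U" and qU: "s - p \<notin> U" using p q not_in_U by auto
    obtain j c where j: "j < n" and p_eq: "p = c \<cdot>\<^sub>v col B j" using line_represented[OF p(1) pU] by blast
    obtain k d where k: "k < n" and q_eq: "s - p = d \<cdot>\<^sub>v col B k"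
      using line_represented[OF q(1) qU] by blast
    let ?e = "d \<cdot>\<^sub>v unit_vec n k + c \<cdot>\<^sub>v unit_vec n j"
    have "B *\<^sub>v ?e = (s - p) + p"
      using mult_add_distrib_mat_vec[OF B, of "d \<cdot>\<^sub>v unit_vec n k" "c \<cdot>\<^sub>v unit_vec n j"]
        mult_smult_unit_vec[OF j] mult_smult_unit_vec[OF k] p_eq q_eq by simp
    also have "\<dots> = s" using s p by (intro eq_vecI) auto
    finally have "B *\<^sub>v ?e = s" .
    moreover have "card {i. i < n \<and> ?e $ i \<noteq> 0} \<le> card {j, k}"
      by (rule card_mono) (auto simp: unit_vec_def split: if_splits)
    moreover have "card {j, k} \<le> 2" by (simp add: card_insert_if)
    ultimately show thesis
      using 3 by (intro that[of ?e]) (auto simp: syndrome_weight_def)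
  qed
qed

lemma dist_to_kernel:
  assumes v: "v \<in> carrier_vec n"
  shows "dist_to_code v (mat_kernel B) = syndrome_weight (B *\<^sub>v v)"
proof -
  have hd: "hamming_dist v x = card {i. i < n \<and> (v - x) $ i \<noteq> 0}" if "x \<in> carrier_vec n" for x
    using v that unfolding hamming_dist_def by (intro arg_cong[where f = card]) auto
  have Bv: "B *\<^sub>v v \<in> carrier_vec m" using B v by simp
  have lower: "syndrome_weight (B *\<^sub>v v) \<le> hamming_dist v x" if "x \<in> mat_kernel B" for x
  proof -
    note x = mat_kernelD[OF B that]
    have "B *\<^sub>v (v - x) = B *\<^sub>v v"
      using mult_minus_distrib_mat_vec[OF B v x(1)] x(2) Bv by simp
    then show ?thesis using syndrome_weight_le[of "v - x"] hd[OF x(1)] v x(1) by simp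
  qed
  obtain e where e: "e \<in> carrier_vec n" "B *\<^sub>v e = B *\<^sub>v v"
    "card {i. i < n \<and> e $ i \<noteq> 0} \<le> syndrome_weight (B *\<^sub>v v)"
    using exists_light_error[OF Bv] .
  have ve: "v - e \<in> mat_kernel B"
    using mult_minus_distrib_mat_vec[OF B v e(1)] e(2) Bv v e(1) by (intro mat_kernelI[OF B]) auto
  have "v - (v - e) = e" using v e(1) by (intro eq_vecI) auto
  then have "hamming_dist v (v - e) \<le> syndrome_weight (B *\<^sub>v v)"
    using hd[of "v - e"] v e by simp
  with lower[OF ve] have "hamming_dist v (v - e) = syndrome_weight (B *\<^sub>v v)" by simp
  moreover have "finite (mat_kernel B)"
    by (rule finite_subset[OF mat_kernel_carrier[OF B] finite_carrier_vec])
  ultimately show ?thesis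
    unfolding dist_to_code_def using lower ve by (intro Min_eqI) (auto intro: rev_image_eqI)
qed

lemma distances: "(\<lambda>v. dist_to_code v (mat_kernel B)) ` carrier_vec n = {..2}"
proof -
  have "(\<lambda>v. dist_to_code v (mat_kernel B)) ` carrier_vec n
      = syndrome_weight ` (\<lambda>v. B *\<^sub>v v) ` carrier_vec n"
    unfolding image_image using dist_to_kernel by (intro image_cong) auto
  also have "(\<lambda>v. B *\<^sub>v v) ` carrier_vec n = carrier_vec m"
  proof
    show "(\<lambda>v. B *\<^sub>v v) ` carrier_vec n \<subseteq> carrier_vec m" using B by auto
    show "carrier_vec m \<subseteq> (\<lambda>v. B *\<^sub>v v) ` carrier_vec n"
    proof
      fix s :: "'a vec" assume "s \<in> carrier_vec m"
      from exists_light_error[OF this] obtain e where "e \<in> carrier_vec n" "B *\<^sub>v e = s" .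
      then show "s \<in> (\<lambda>v. B *\<^sub>v v) ` carrier_vec n" by blast
    qed
  qed
  also have "syndrome_weight ` carrier_vec m = {..2}"
  proof
    show "syndrome_weight ` carrier_vec m \<subseteq> {..2}" by (auto simp: syndrome_weight_def)
    have "unit_vec m 0 \<in> U" using u_pos u_less by (auto simp: last_zero_space_def)
    moreover have "unit_vec m u \<notin> U" using u_less by (intro not_in_U) simp
    moreover have "unit_vec m 0 \<noteq> (0\<^sub>v m :: 'a vec)" "unit_vec m u \<noteq> (0\<^sub>v m :: 'a vec)"
      using u_less by simp_all
    ultimately have "syndrome_weight ` {0\<^sub>v m, unit_vec m u, unit_vec m 0} = {0, 1, 2}"
      by (auto simp: syndrome_weight_def)
    moreover have "{..2} = {0, 1, 2 :: nat}" by auto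
    moreover have "{0\<^sub>v m, unit_vec m u, unit_vec m 0} \<subseteq> carrier_vec m" by simp
    ultimately show "{..2} \<subseteq> syndrome_weight ` carrier_vec m" by (metis image_mono)
  qed
  finally show ?thesis .
qed

lemma linear_code_kernel: "linear_code n (mat_kernel B)"
proof -
  interpret vec_space "TYPE('a)" n .
  show ?thesis
    unfolding linear_code_def
  proof (intro subspace.intro submodule.intro)
    show "vectorspace class_ring V" "module class_ring V" by unfold_locales
  qed (use B mult_add_distrib_mat_vec[OF B] mult_mat_vec[OF B]
      in \<open>auto simp: mat_kernel[OF B] module_vec_simps\<close>)
qed

lemma code_coset_kernel:
  assumes v: "v \<in> carrier_vec n"
  shows "code_coset n v (mat_kernel B) = {x \<in> carrier_vec n. B *\<^sub>v x = B *\<^sub>v v}"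
proof (intro equalityI subsetI)
  fix x assume "x \<in> code_coset n v (mat_kernel B)"
  then obtain c where c: "c \<in> mat_kernel B" and x: "x = v + c" by (auto simp: mem_code_coset)
  note c = mat_kernelD[OF B c]
  have "B *\<^sub>v v \<in> carrier_vec m" using B v by simp
  then show "x \<in> {x \<in> carrier_vec n. B *\<^sub>v x = B *\<^sub>v v}"
    using mult_add_distrib_mat_vec[OF B v c(1)] c x v by simp
next
  fix x assume x: "x \<in> {x \<in> carrier_vec n. B *\<^sub>v x = B *\<^sub>v v}"
  have "B *\<^sub>v v \<in> carrier_vec m" using B v by simp
  then have "x - v \<in> mat_kernel B"
    using mult_minus_distrib_mat_vec[OF B _ v, of x] x v by (intro mat_kernelI[OF B]) auto
  moreover have "x = v + (x - v)" using x v by (intro eq_vecI) auto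
  ultimately show "x \<in> code_coset n v (mat_kernel B)" by (auto simp: mem_code_coset)
qed

text \<open>
  Write \<open>b\<^sub>j\<close> for the columns of \<open>B\<close>. Each \<open>T b\<^sub>j\<close> lies outside \<open>U\<close>, so \<open>T b\<^sub>j = l\<^sub>j b\<^sub>\<pi>\<^sub>(\<^sub>j\<^sub>)\<close> with
  \<open>l\<^sub>j \<noteq> 0\<close>; injectivity of \<open>T\<close> makes \<open>\<pi>\<close> injective, hence a permutation. The monomial matrix with
  entries \<open>l\<^sub>j\<close> at \<open>(j, \<pi> j)\<close> then satisfies \<open>B M\<^sup>T = T B\<close>.
\<close>

lemma automorphism_realizing:
  assumes T: "T \<in> carrier_mat m m"
    and inj: "\<And>x. x \<in> carrier_vec m \<Longrightarrow> T *\<^sub>v x = 0\<^sub>v m \<Longrightarrow> x = 0\<^sub>v m"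
    and pres: "\<And>x. x \<in> carrier_vec m \<Longrightarrow> T *\<^sub>v x \<in> U \<longleftrightarrow> x \<in> U"
  obtains f where "f \<in> carrier (Aut_code n (mat_kernel B))"
    "\<And>x. x \<in> carrier_vec n \<Longrightarrow> B *\<^sub>v f x = T *\<^sub>v (B *\<^sub>v x)"
proof -
  have "\<forall>j. \<exists>k l. j < n \<longrightarrow> k < n \<and> l \<noteq> 0 \<and> T *\<^sub>v col B j = l \<cdot>\<^sub>v col B k"
  proof
    fix j
    show "\<exists>k l. j < n \<longrightarrow> k < n \<and> l \<noteq> 0 \<and> T *\<^sub>v col B j = l \<cdot>\<^sub>v col B k"
      using line_represented[of "T *\<^sub>v col B j"] T col_carrier[of j] pres[OF col_carrier] col_outside
      by (metis mult_mat_vec_carrier)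
  qed
  then obtain \<pi> l where \<pi>: "\<And>j. j < n \<Longrightarrow> \<pi> j < n" and l: "\<And>j. j < n \<Longrightarrow> l j \<noteq> 0"
    and Tcol: "\<And>j. j < n \<Longrightarrow> T *\<^sub>v col B j = l j \<cdot>\<^sub>v col B (\<pi> j)"
    by metis
  have inj_\<pi>: "inj_on \<pi> {..<n}"
  proof (rule inj_onI)
    fix j k assume "j \<in> {..<n}" "k \<in> {..<n}" and eq: "\<pi> j = \<pi> k"
    then have j: "j < n" and k: "k < n" by auto
    let ?z = "l k \<cdot>\<^sub>v col B j - l j \<cdot>\<^sub>v col B k"
    have z: "?z \<in> carrier_vec m" using col_carrier by simp
    have "T *\<^sub>v ?z = l k \<cdot>\<^sub>v (l j \<cdot>\<^sub>v col B (\<pi> k)) - l j \<cdot>\<^sub>v (l k \<cdot>\<^sub>v col B (\<pi> k))"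
      using mult_minus_distrib_mat_vec[OF T, of "l k \<cdot>\<^sub>v col B j" "l j \<cdot>\<^sub>v col B k"]
        mult_mat_vec[OF T col_carrier] Tcol[OF j] Tcol[OF k] eq col_carrier by simp
    also have "\<dots> = 0\<^sub>v m" using B by (intro eq_vecI) auto
    finally have "?z = 0\<^sub>v m" by (rule inj[OF z])
    have "l k \<cdot>\<^sub>v col B j = l j \<cdot>\<^sub>v col B k"
    proof (rule eq_vecI)
      fix i assume "i < dim_vec (l j \<cdot>\<^sub>v col B k)"
      then show "(l k \<cdot>\<^sub>v col B j) $ i = (l j \<cdot>\<^sub>v col B k) $ i"
        using arg_cong[OF \<open>?z = 0\<^sub>v m\<close>, of "\<lambda>v. v $ i"] B by simp
    qed simp
    then show "j = k" using line_unique[OF j k l[OF k]] by blast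
  qed
  have "\<pi> ` {..<n} = {..<n}" using inj_\<pi> \<pi> by (intro endo_inj_surj) auto
  then have surj_\<pi>: "\<exists>j<n. \<pi> j = k" if "k < n" for k using that by (metis imageE lessThan_iff)
  define M where "M = mat n n (\<lambda>(j, k). if k = \<pi> j then l j else 0)"
  have M: "M \<in> carrier_mat n n" by (simp add: M_def)
  have entry: "M $$ (j, k) \<noteq> 0 \<longleftrightarrow> k = \<pi> j" if "j < n" "k < n" for j k
    using that l by (simp add: M_def)
  have "\<exists>!k. k < n \<and> M $$ (j, k) \<noteq> 0" if "j < n" for j
    using entry[OF that] \<pi>[OF that] by blast
  moreover have "\<exists>!j. j < n \<and> M $$ (j, k) \<noteq> 0" if k: "k < n" for k
  proof -
    obtain j where "j < n" "\<pi> j = k" using surj_\<pi>[OF k] by blast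
    then show ?thesis using entry[OF _ k] inj_onD[OF inj_\<pi>, of j] by (intro ex1I[of _ j]) auto
  qed
  ultimately have mono: "monomial_mat n M" using M by (simp add: monomial_mat_def)
  have "B * transpose_mat M = T * B"
  proof (rule mat_col_eqI)
    fix j assume "j < dim_col (T * B)"
    then have j: "j < n" using B by simp
    have "col (transpose_mat M) j = l j \<cdot>\<^sub>v unit_vec n (\<pi> j)"
      using j \<pi>[OF j] M by (intro eq_vecI) (auto simp: M_def)
    then have "col (B * transpose_mat M) j = l j \<cdot>\<^sub>v col B (\<pi> j)"
      using col_mult2[OF B _ j, of "transpose_mat M"] M mult_smult_unit_vec[OF \<pi>[OF j]] by simp
    then show "col (B * transpose_mat M) j = col (T * B) j"
      using col_mult2[OF T B j] Tcol[OF j] by simp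
  qed (use B T M in auto)
  define f where "f = (\<lambda>x\<in>carrier_vec n. map_vec id (transpose_mat M *\<^sub>v x))"
  have f_eq: "f x = transpose_mat M *\<^sub>v x" if "x \<in> carrier_vec n" for x
    using that by (auto simp: f_def intro: eq_vecI)
  have f_closed: "f x \<in> carrier_vec n" if "x \<in> carrier_vec n" for x
    using M f_eq[OF that] that by simp
  have Bf: "B *\<^sub>v f x = T *\<^sub>v (B *\<^sub>v x)" if x: "x \<in> carrier_vec n" for x
  proof -
    have "B *\<^sub>v f x = (B * transpose_mat M) *\<^sub>v x"
      using f_eq[OF x] assoc_mult_mat_vec[OF B _ x, of "transpose_mat M"] M by simp
    also have "\<dots> = T *\<^sub>v (B *\<^sub>v x)"
      unfolding \<open>B * transpose_mat M = T * B\<close> by (rule assoc_mult_mat_vec[OF T B x])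
    finally show ?thesis .
  qed
  have "field_isom (id :: 'a \<Rightarrow> 'a)" by unfold_locales auto
  then have semi: "f \<in> semilinear_monomial_maps n"
    using mono unfolding semilinear_monomial_maps_def f_def by blast
  have "T *\<^sub>v 0\<^sub>v m = 0\<^sub>v m" using T by (intro eq_vecI) auto
  then have "f ` mat_kernel B \<subseteq> mat_kernel B"
    using Bf f_closed by (auto simp: mat_kernel[OF B])
  moreover have "inj_on f (mat_kernel B)"
  proof (rule inj_onI)
    fix x y assume "x \<in> mat_kernel B" "y \<in> mat_kernel B" and eq: "f x = f y"
    then have xy: "x \<in> carrier_vec n" "y \<in> carrier_vec n" by (auto simp: mat_kernel[OF B])
    have "hamming_dist x y = hamming_dist (f x) (f y)"
      using hamming_dist_semilinear_monomial[OF semi xy] by simp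
    also have "\<dots> = 0" by (simp add: eq hamming_dist_def)
    finally have "\<forall>i<n. x $ i = y $ i" using xy by (auto simp: hamming_dist_def)
    then show "x = y" using xy by (intro eq_vecI) auto
  qed
  moreover have "finite (mat_kernel B)"
    by (rule finite_subset[OF mat_kernel_carrier[OF B] finite_carrier_vec])
  ultimately have "f ` mat_kernel B = mat_kernel B" by (intro endo_inj_surj)
  then have "f \<in> carrier (Aut_code n (mat_kernel B))" using semi by (simp add: Aut_code_def)
  then show thesis using Bf by (rule that)
qed

theorem completely_transitive_kernel: "completely_transitive n (mat_kernel B)"
proof (rule completely_transitiveI[OF linear_code_kernel distances])
  fix v w assume v: "v \<in> carrier_vec n" and w: "w \<in> carrier_vec n"
    and "dist_to_code v (mat_kernel B) = dist_to_code w (mat_kernel B)"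
  then have wt: "syndrome_weight (B *\<^sub>v v) = syndrome_weight (B *\<^sub>v w)"
    by (simp add: dist_to_kernel)
  have carr: "B *\<^sub>v v \<in> carrier_vec m" "B *\<^sub>v w \<in> carrier_vec m" using B v w by auto
  obtain T where T: "T \<in> carrier_mat m m" "T *\<^sub>v (B *\<^sub>v v) = B *\<^sub>v w"
    "\<And>x. x \<in> carrier_vec m \<Longrightarrow> T *\<^sub>v x = 0\<^sub>v m \<Longrightarrow> x = 0\<^sub>v m"
    "\<And>x. x \<in> carrier_vec m \<Longrightarrow> T *\<^sub>v x \<in> U \<longleftrightarrow> x \<in> U"
  proof (cases "B *\<^sub>v v = 0\<^sub>v m")
    case True
    then have "B *\<^sub>v w = 0\<^sub>v m" using wt by (auto simp: syndrome_weight_def split: if_splits)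
    then show thesis using True by (intro that[of "1\<^sub>m m"]) auto
  next
    case False
    then have "B *\<^sub>v w \<noteq> 0\<^sub>v m" "B *\<^sub>v v \<in> U \<longleftrightarrow> B *\<^sub>v w \<in> U"
      using wt by (auto simp: syndrome_weight_def split: if_splits)
    from subspace_stabilizer_transitive[OF carr(1) False carr(2) this] that show thesis by metis
  qed
  obtain f where f: "f \<in> carrier (Aut_code n (mat_kernel B))"
    and Bf: "\<And>x. x \<in> carrier_vec n \<Longrightarrow> B *\<^sub>v f x = T *\<^sub>v (B *\<^sub>v x)"
    using automorphism_realizing[OF T(1,3,4)] by metis
  have "code_coset n (f v) (mat_kernel B) = code_coset n w (mat_kernel B)"
    using code_coset_kernel[OF Aut_code_closed[OF f v]] code_coset_kernel[OF w] Bf[OF v] T(2) by simp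
  then show "\<exists>f\<in>carrier (Aut_code n (mat_kernel B)).
      code_coset n (f v) (mat_kernel B) = code_coset n w (mat_kernel B)"
    using f by blast
qed

end

section \<open>Columns of a Hamming parity-check matrix\<close>

lemma lin_dep_finite_iff:
  fixes S :: "'a :: field vec set"
  assumes S: "finite S" "S \<subseteq> carrier_vec m"
  shows "LinearCombinations.module.lin_dep class_ring (module_vec TYPE('a) m) S \<longleftrightarrow>
    (\<exists>a. (\<forall>i<m. (\<Sum>x\<in>S. a x * x $ i) = 0) \<and> (\<exists>x\<in>S. a x \<noteq> 0))"
proof -
  interpret vec_space "TYPE('a)" m .
  have zero: "lincomb a S = 0\<^sub>v m \<longleftrightarrow> (\<forall>i<m. (\<Sum>x\<in>S. a x * x $ i) = 0)" for a
  proof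
    assume *: "lincomb a S = 0\<^sub>v m"
    show "\<forall>i<m. (\<Sum>x\<in>S. a x * x $ i) = 0"
    proof (intro allI impI)
      fix i assume i: "i < m"
      then show "(\<Sum>x\<in>S. a x * x $ i) = 0"
        using lincomb_index[OF i S(2), of a] unfolding * by simp
    qed
  next
    assume "\<forall>i<m. (\<Sum>x\<in>S. a x * x $ i) = 0"
    then show "lincomb a S = 0\<^sub>v m"
      using lincomb_dim[OF S, of a] by (intro eq_vecI) (auto simp: lincomb_index[OF _ S(2)])
  qed
  show ?thesis
  proof
    assume "lin_dep S"
    from finite_lin_dep[OF S(1) this] S(2) zero
    show "\<exists>a. (\<forall>i<m. (\<Sum>x\<in>S. a x * x $ i) = 0) \<and> (\<exists>x\<in>S. a x \<noteq> 0)"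
      by auto
  next
    assume "\<exists>a. (\<forall>i<m. (\<Sum>x\<in>S. a x * x $ i) = 0) \<and> (\<exists>x\<in>S. a x \<noteq> 0)"
    then obtain a x where "lincomb a S = 0\<^sub>v m" "x \<in> S" "a x \<noteq> 0" using zero by blast
    then show "lin_dep S" using S(1) by (intro lin_dep_crit[where A = S and a = a and v = x]) auto
  qed
qed

lemma lin_indpt_pair_iff:
  fixes v w :: "'a :: field vec"
  assumes v: "v \<in> carrier_vec m" "v \<noteq> 0\<^sub>v m" and w: "w \<in> carrier_vec m" "w \<noteq> 0\<^sub>v m" and ne: "v \<noteq> w"
  shows "LinearCombinations.module.lin_indpt class_ring (module_vec TYPE('a) m) {v, w} \<longleftrightarrow>
    (\<forall>c. c \<noteq> 0 \<longrightarrow> w \<noteq> c \<cdot>\<^sub>v v)" (is "\<not> ?dep \<longleftrightarrow> ?rhs")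
proof -
  have dep: "?dep \<longleftrightarrow> (\<exists>a. (\<forall>i<m. a v * v $ i + a w * w $ i = 0) \<and> (a v \<noteq> 0 \<or> a w \<noteq> 0))"
    using v w ne by (subst lin_dep_finite_iff) auto
  have "?dep \<longleftrightarrow> (\<exists>c. c \<noteq> 0 \<and> w = c \<cdot>\<^sub>v v)"
  proof
    assume ?dep
    then obtain a where a: "\<And>i. i < m \<Longrightarrow> a v * v $ i + a w * w $ i = 0" "a v \<noteq> 0 \<or> a w \<noteq> 0"
      using dep by blast
    have "a v \<noteq> 0"
    proof
      assume "a v = 0"
      then have "w = 0\<^sub>v m" using a w by (intro eq_vecI) auto
      then show False using w by simp
    qed
    moreover have aw: "a w \<noteq> 0"
    proof
      assume "a w = 0"
      then have "v = 0\<^sub>v m" using a v by (intro eq_vecI) auto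
      then show False using v by simp
    qed
    moreover have "w = (- a v / a w) \<cdot>\<^sub>v v"
    proof (rule eq_vecI)
      fix i assume "i < dim_vec ((- a v / a w) \<cdot>\<^sub>v v)"
      then have i: "i < m" using v by simp
      have "a w * w $ i = - (a v * v $ i)" using a(1)[OF i] by (simp add: add_eq_0_iff2 add.commute)
      then show "w $ i = ((- a v / a w) \<cdot>\<^sub>v v) $ i" using i v aw by (simp add: field_simps)
    qed (use v w in auto)
    ultimately show "\<exists>c. c \<noteq> 0 \<and> w = c \<cdot>\<^sub>v v" by (intro exI[of _ "- a v / a w"]) auto
  next
    assume "\<exists>c. c \<noteq> 0 \<and> w = c \<cdot>\<^sub>v v"
    then obtain c where "w = c \<cdot>\<^sub>v v" by blast
    then show ?dep unfolding dep
      using v ne by (intro exI[of _ "\<lambda>x. if x = v then - c else 1"]) auto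
  qed
  then show ?thesis by blast
qed

lemma lin_indpt_singleton_iff:
  fixes v :: "'a :: field vec"
  assumes v: "v \<in> carrier_vec m"
  shows "LinearCombinations.module.lin_indpt class_ring (module_vec TYPE('a) m) {v} \<longleftrightarrow> v \<noteq> 0\<^sub>v m"
proof -
  have "(\<forall>i<m. v $ i = 0) \<longleftrightarrow> v = 0\<^sub>v m"
    using v by (auto intro!: eq_vecI)
  moreover have "(\<exists>a. (\<forall>i<m. a v * v $ i = 0) \<and> a v \<noteq> 0) \<longleftrightarrow> (\<forall>i<m. v $ i = 0)"
    by (auto intro: exI[of _ "\<lambda>_. 1"])
  ultimately show ?thesis using v by (subst lin_dep_finite_iff) auto
qed

text \<open>
  The singletons among the pairs \<open>{v, w}\<close> exclude the zero vector; for distinct nonzero vectors,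
  dependence means proportionality.
\<close>

lemma pairwise_lin_indpt_iff:
  fixes S :: "'a :: field vec set"
  assumes S: "S \<subseteq> carrier_vec m"
  shows "pairwise_lin_indpt m S \<longleftrightarrow>
    0\<^sub>v m \<notin> S \<and> (\<forall>v\<in>S. \<forall>w\<in>S. \<forall>c. c \<noteq> 0 \<and> w = c \<cdot>\<^sub>v v \<longrightarrow> v = w)"
proof (cases "0\<^sub>v m \<in> S")
  case True
  then have "\<not> pairwise_lin_indpt m S"
    using lin_indpt_singleton_iff[of "0\<^sub>v m" m] unfolding pairwise_lin_indpt_def by fastforce
  then show ?thesis using True by blast
next
  case False
  have "LinearCombinations.module.lin_indpt class_ring (module_vec TYPE('a) m) {v, w}
      \<longleftrightarrow> (\<forall>c. c \<noteq> 0 \<and> w = c \<cdot>\<^sub>v v \<longrightarrow> v = w)" if "v \<in> S" "w \<in> S" for v w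
  proof (cases "v = w")
    case True
    then show ?thesis using that S False lin_indpt_singleton_iff[of v m] by auto
  next
    case ne: False
    have "v \<in> carrier_vec m" "v \<noteq> 0\<^sub>v m" "w \<in> carrier_vec m" "w \<noteq> 0\<^sub>v m"
      using that S False by auto
    from lin_indpt_pair_iff[OF this ne] show ?thesis using ne by blast
  qed
  then show ?thesis using False by (auto simp: pairwise_lin_indpt_def)
qed

text \<open>
  A vector on no line spanned by a member of a maximal set could be added to the set.
\<close>

lemma maximal_pairwise_lin_indpt_represents:
  fixes S :: "'a :: field vec set"
  assumes max: "maximal S (\<lambda>S. S \<subseteq> carrier_vec m \<and> pairwise_lin_indpt m S)"
    and w: "w \<in> carrier_vec m" "w \<noteq> 0\<^sub>v m"
  shows "\<exists>v\<in>S. \<exists>c. c \<noteq> 0 \<and> w = c \<cdot>\<^sub>v v"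
proof (rule ccontr)
  assume none: "\<not> ?thesis"
  have S: "S \<subseteq> carrier_vec m" "pairwise_lin_indpt m S" using max by (auto simp: maximal_def)
  have none': "v \<noteq> c \<cdot>\<^sub>v w" if "v \<in> S" "c \<noteq> 0" for v c
  proof
    assume "v = c \<cdot>\<^sub>v w"
    then have "w = (1 / c) \<cdot>\<^sub>v v" using that by (simp add: smult_smult_assoc)
    then show False using none that by (metis divide_eq_0_iff zero_neq_one)
  qed
  have sub: "insert w S \<subseteq> carrier_vec m" using S w by simp
  have "pairwise_lin_indpt m (insert w S)"
    using S(2) w none none' unfolding pairwise_lin_indpt_iff[OF S(1)] pairwise_lin_indpt_iff[OF sub]
    by blast
  then have "insert w S = S" using max sub unfolding maximal_def by blast
  then have "w \<in> S" by blast
  then show False using none by (metis one_smult_vec zero_neq_one)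
qed

text \<open>
  The columns of \<open>A\<close> lie in \<open>U\<close>, so lines outside \<open>U\<close> can only be represented by columns of \<open>B\<close>.
\<close>

lemma hamming_split_lines_outside:
  fixes A B :: "'a :: {field, finite} mat"
  assumes u: "1 \<le> u" "u \<le> m - 1" and split: "hamming_split u m A B"
  shows "lines_outside u m ((CARD('a) ^ m - CARD('a) ^ u) div (CARD('a) - 1)) B"
proof -
  let ?n = "(CARD('a) ^ m - CARD('a) ^ u) div (CARD('a) - 1)"
  let ?U = "last_zero_space u m :: 'a vec set"
  let ?S = "set (cols A) \<union> set (cols B)"
  have B: "B \<in> carrier_mat m ?n" using split by (simp add: hamming_split_def)
  obtain p where A: "A \<in> carrier_mat m p" using split by (auto simp: hamming_split_def)
  have sub: "set (cols A @ cols B) \<subseteq> carrier_vec m" using A B cols_dim[of A] cols_dim[of B] by auto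
  have cols: "cols (mat_of_cols m (cols A @ cols B)) = cols A @ cols B"
    by (rule cols_mat_of_cols[OF sub])
  have max: "maximal ?S (\<lambda>S. S \<subseteq> carrier_vec m \<and> pairwise_lin_indpt m S)"
    and dist: "distinct (cols B)"
    using split unfolding hamming_split_def hamming_parity_check_def cols by auto
  have colsB: "set (cols B) = col B ` {..<?n}" using B by (auto simp: cols_def)
  have in_U: "x \<in> ?U" if "x \<in> set (cols A)" for x
    using split that sub unfolding hamming_split_def last_zero_space_def by auto
  show ?thesis
  proof
    show "0 < u" "u < m" using u by auto
    show "B \<in> carrier_mat m ?n" by fact
    show "col B j \<notin> ?U" if "j < ?n" for j
      using split that colsB unfolding hamming_split_def last_zero_space_def by blast
  next
    fix w assume w: "w \<in> carrier_vec m" "w \<notin> ?U"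
    then have "w \<noteq> 0\<^sub>v m" using zero_in_last_zero_space by blast
    then obtain v c where v: "v \<in> ?S" and c: "c \<noteq> 0" "w = c \<cdot>\<^sub>v v"
      using maximal_pairwise_lin_indpt_represents[OF max w(1)] by blast
    have "v \<notin> ?U" using w(2) c smult_in_last_zero_space_iff[OF c(1)] v sub by auto
    then have "v \<in> col B ` {..<?n}" using v in_U colsB by blast
    then show "\<exists>j<?n. \<exists>c. c \<noteq> 0 \<and> w = c \<cdot>\<^sub>v col B j" using c by blast
  next
    fix j k :: nat and c d :: 'a
    assume jk: "j < ?n" "k < ?n" and c: "c \<noteq> 0" and eq: "c \<cdot>\<^sub>v col B j = d \<cdot>\<^sub>v col B k"
    have S: "?S \<subseteq> carrier_vec m" "pairwise_lin_indpt m ?S" using max by (auto simp: maximal_def)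
    note indpt = S(2)[unfolded pairwise_lin_indpt_iff[OF S(1)]]
    have mem: "col B j \<in> ?S" "col B k \<in> ?S" using jk colsB by auto
    have "col B j = (1 / c) \<cdot>\<^sub>v (c \<cdot>\<^sub>v col B j)" using c by (simp add: smult_smult_assoc)
    also have "\<dots> = (d / c) \<cdot>\<^sub>v col B k" unfolding eq by (simp add: smult_smult_assoc)
    finally have mult: "col B j = (d / c) \<cdot>\<^sub>v col B k" .
    have "d \<noteq> 0"
    proof
      assume "d = 0"
      then have "col B j = 0\<^sub>v m" using mult B by (intro eq_vecI) auto
      then show False using mem(1) indpt by metis
    qed
    then have "col B k = col B j" using indpt mem mult c by (metis divide_eq_0_iff)
    then show "j = k" using dist jk B by (metis carrier_matD(2) cols_length cols_nth nth_eq_iff_index_eq)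
  qed
qed

theorem corollary2:
  fixes m u :: nat
    and Hu Hum :: "'a :: {field, finite} mat"
  assumes "m > 1" and "1 \<le> u" and "u \<le> m - 1"
    and "hamming_split u m Hu Hum"
  shows "completely_transitive ((CARD('a) ^ m - CARD('a) ^ u) div (CARD('a) - 1)) (mat_kernel Hum)"
  using lines_outside.completely_transitive_kernel[OF hamming_split_lines_outside[OF assms(2-4)]] .

end
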